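(* Let $k$ be a positive integer, $0\le\gamma<1$, $\phi\in\mathcal{S}^*\left(\frac{k-1}{k}\right)$, and let $\mathfrak{f}=\mathfrak{u}+\overline{\mathfrak{v}}\in\mathcal{KH}^{0}(k,\gamma)$. Then for all $z\in\mathbb{E}$, $$|z|+\sum_{m=2}^{\infty}(-1)^{m-1}[m(1-\gamma)+\gamma]\,|z|^m\le|\mathfrak{f}(z)|\le|z|+\sum_{m=2}^{\infty}[m(1-\gamma)+\gamma]\,|z|^m.$$ These inequalities are sharp for the function $\mathfrak{f}(z)=z+\sum_{m=2}^{\infty}[m(1-\gamma)+\gamma]z^m$.
   Context: $\mathbb{E}=\{z\in\mathbb{C}:|z|<1\}$. $\mathcal{SH}^0$ is the class of univalent, sense-preserving harmonic functions $\mathfrak{f}=\mathfrak{u}+\overline{\mathfrak{v}}$ on $\mathbb{E}$, where $\mathfrak{u}(z)=z+\sum_{m=2}^\infty u_m z^m$ and $\mathfrak{v}(z)=\sum_{m=2}^\infty v_m z^m$ are analytic in $\mathbb{E}$. For $0\le\beta<1$, $\mathcal{S}^*(\beta)$ is the class of analytic functions $\phi(z)=z+\sum_{m=2}^\infty c_m z^m$ on $\mathbb{E}$ that are starlike of order $\beta$, i.e. $\mathrm{Re}\{z\phi'(z)/\phi(z)\}>\beta$ in $\mathbb{E}$. Given a positive integer $k$ and a fixed $\phi\in\mathcal{S}^*\left(\frac{k-1}{k}\right)$, put $\mu=e^{2\pi i/k}$ and $\phi_k(z)=\prod_{v=0}^{k-1}\mu^{-v}\phi(\mu^v z)$. For $0\le\gamma<1$,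 $\mathcal{KH}^0(k,\gamma)$ is the class of all $\mathfrak{f}=\mathfrak{u}+\overline{\mathfrak{v}}\in\mathcal{SH}^0$ satisfying, for all $z\in\mathbb{E}$, $$\mathrm{Re}\left\{\frac{z^k\mathfrak{u}'(z)}{\phi_k(z)}-\gamma\right\}>\left|\frac{z^k\mathfrak{v}'(z)}{\phi_k(z)}\right|$$ (the quotient $z^k/\phi_k(z)$ has a removable singularity at $0$, with value $1$ there).
   Formalization: The sharpness function is shown to lie in the class only for k=1 (some φ in S*(0)), where it attains both bounds; for k≥2 it is in no such class, since z^k/φ_k has no linear term, forcing |u_2| ≤ 1-γ while its u_2 is 2-γ. The bounds are proved for all k. *)

theory Defs
  imports "HOL-Complex_Analysis.Complex_Analysis"
begin

abbreviation unit_disc :: "complex set" where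
  "unit_disc \<equiv> ball 0 1"

text \<open>
  Functions are total on the type of complex numbers; every class below constrains only their
  values on the open unit disc.

  The expansions $z + \sum_{m \ge 2} c_m z^m$ and $\sum_{m \ge 2} c_m z^m$ of a function analytic
  in the disc amount to prescribing the value and the first derivative at the origin.
\<close>

definition starlike_class :: "real \<Rightarrow> (complex \<Rightarrow> complex) set" where
  "starlike_class \<beta> = {\<phi>. \<phi> holomorphic_on unit_disc \<and> \<phi> 0 = 0 \<and> deriv \<phi> 0 = 1 \<and>
     (\<forall>z \<in> unit_disc - {0}. \<phi> z \<noteq> 0 \<and> Re (z * deriv \<phi> z / \<phi> z) > \<beta>)}"
  \<comment> \<open>At the origin the quotient has a removable singularity with value \<open>1\<close>, which exceeds
      \<open>\<beta>\<close> for every \<open>\<beta> < 1\<close>; since \<open>0 / 0 = 0\<close> in HOL, that point has to be left out.\<close>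

definition harmonic_decomposition ::
  "(complex \<Rightarrow> complex) \<Rightarrow> (complex \<Rightarrow> complex) \<Rightarrow> (complex \<Rightarrow> complex) \<Rightarrow> bool" where
  "harmonic_decomposition f u v \<longleftrightarrow>
     u holomorphic_on unit_disc \<and> u 0 = 0 \<and> deriv u 0 = 1 \<and>
     v holomorphic_on unit_disc \<and> v 0 = 0 \<and> deriv v 0 = 0 \<and>
     (\<forall>z \<in> unit_disc. f z = u z + cnj (v z))"
  \<comment> \<open>On the disc \<open>f\<close> determines \<open>u\<close> and \<open>v\<close>, because \<open>v 0 = 0\<close>.\<close>

definition SH0 :: "(complex \<Rightarrow> complex) set" where
  "SH0 = {f. inj_on f unit_disc \<and>
     (\<exists>u v. harmonic_decomposition f u v \<and>
        (\<forall>z \<in> unit_disc. (norm (deriv u z))\<^sup>2 - (norm (deriv v z))\<^sup>2 > 0))}"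
  \<comment> \<open>The last condition is sense-preservation: the difference is the Jacobian of \<open>u + cnj v\<close>.\<close>

definition rotation_product :: "nat \<Rightarrow> (complex \<Rightarrow> complex) \<Rightarrow> complex \<Rightarrow> complex" where
  "rotation_product k \<phi> z =
     (let \<mu> = exp (2 * of_real pi * \<i> / of_nat k)
      in \<Prod>v<k. \<mu> powi (- int v) * \<phi> (\<mu> ^ v * z))"

definition rotation_quotient :: "nat \<Rightarrow> (complex \<Rightarrow> complex) \<Rightarrow> complex \<Rightarrow> complex" where
  "rotation_quotient k \<phi> z = (if z = 0 then 1 else z ^ k / rotation_product k \<phi> z)"
  \<comment> \<open>The value at the origin removes the singularity there.\<close>

definition KH0 :: "nat \<Rightarrow> real \<Rightarrow> (complex \<Rightarrow> complex) \<Rightarrow> (complex \<Rightarrow> complex) set" where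
  "KH0 k \<gamma> \<phi> = {f \<in> SH0. \<exists>u v. harmonic_decomposition f u v \<and>
     (\<forall>z \<in> unit_disc. Re (rotation_quotient k \<phi> z * deriv u z - of_real \<gamma>)
                        > norm (rotation_quotient k \<phi> z * deriv v z))}"

definition extremal :: "real \<Rightarrow> complex \<Rightarrow> complex" where
  "extremal \<gamma> z = z + (\<Sum>\<^sub>\<infinity>m\<in>{2..}. of_real (real m * (1 - \<gamma>) + \<gamma>) * z ^ m)"
  \<comment> \<open>Membership in \<open>KH0 k \<gamma> \<phi>\<close> is possible for \<open>k = 1\<close> only: for \<open>k \<ge> 2\<close> the function
      \<open>rotation_product k \<phi> z / z ^ (k - 1)\<close> has no quadratic term, which bounds the second
      coefficient of \<open>u\<close> by \<open>1 - \<gamma>\<close>, whereas that of \<open>extremal \<gamma>\<close> is \<open>2 - \<gamma>\<close>.\<close>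

end

theory Submission
  imports Defs
begin

text \<open>
  The hypothesis says that, with \<open>Q = z\<^sup>k / \<phi>\<^sub>k\<close> and any unimodular \<open>\<epsilon>\<close>, the holomorphic function
  \<open>P = Q (u' + \<epsilon> v')\<close> has real part greater than \<open>\<gamma>\<close> and \<open>P 0 = 1\<close>. The Schwarz lemma therefore
  controls \<open>P\<close> (\<open>caratheodory_bounds\<close>), and a suitable choice of \<open>\<epsilon>\<close> at each point turns this into bounds on
  \<open>\<bar>Q\<bar> (\<bar>u'\<bar> + \<bar>v'\<bar>)\<close> and \<open>\<bar>Q\<bar> (\<bar>u'\<bar> - \<bar>v'\<bar>)\<close>.

  The factor \<open>Q\<close> is estimated through \<open>1 / Q = \<Prod>\<^sub>v h (\<mu>\<^sup>v z)\<close> with \<open>h z = \<phi> z / z\<close>. Starlikeness of order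
  \<open>\<beta>\<close> bounds the radial derivative of \<open>log \<bar>h\<bar>\<close>, so that \<open>\<bar>h\<bar>\<close> lies between
  \<open>(1 + r) powr (- 2 (1 - \<beta>))\<close> and \<open>(1 - r) powr (- 2 (1 - \<beta>))\<close>, where \<open>r = \<bar>z\<bar>\<close>. Since
  \<open>\<beta> = (k - 1) / k\<close>, the product of \<open>k\<close> such factors has exponent \<open>- 2\<close> whatever \<open>k\<close> is
  (\<open>rotation_quotient_bounds\<close>).

  Let \<open>K z = (1 - \<gamma>) z / (1 - z)\<^sup>2 + \<gamma> z / (1 - z)\<close>, which is the sum of the series that defines the extremal
  function. The two estimates combine to \<open>\<bar>u'\<bar> + \<bar>v'\<bar> \<le> K' r\<close> and \<open>\<bar>u'\<bar> - \<bar>v'\<bar> \<ge> K' (- r)\<close>, and the bounds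
  of the theorem are \<open>K r\<close> and \<open>- K (- r)\<close>. Integration along the radius gives the upper bound. For the lower
  bound one integrates instead along the preimage of the segment from \<open>0\<close> to a value of \<open>f\<close> of least modulus
  on the circle of radius \<open>r\<close>; here univalence enters (\<open>injective_expanding_norm_ge\<close>).

  On the real axis \<open>K\<close> attains both bounds, and it belongs to the class for \<open>k = 1\<close> and the Koebe function
  \<open>z / (1 - z)\<^sup>2\<close>: it equals \<open>w + (1 - \<gamma>) w\<^sup>2\<close> with \<open>w = z / (1 - z)\<close> in the half-plane \<open>Re w > - 1 / 2\<close>,
  where this quadratic polynomial is injective.
\<close>

section \<open>Growth of injective expanding maps\<close>

text \<open>
  Suppose that the derivative of \<open>f\<close> expands lengths by at least \<open>m \<rho>\<close> at distance \<open>\<rho>\<close> from the origin. Along a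
  segment from \<open>0\<close> to \<open>w\<close> in the image, the inverse of \<open>f\<close> moves so slowly that
  \<open>M \<circ> norm \<circ> inverse\<close> grows at most at the rate \<open>norm w\<close>. The segment to \<open>f x\<close> itself need not lie in the
  image; the one to a point \<open>f z\<close> of least norm with \<open>norm z = norm x\<close> does, and it is enough to
  treat that point.
\<close>

lemma injective_expanding_norm_ge:
  fixes f :: "'a::euclidean_space \<Rightarrow> 'a" and M m :: "real \<Rightarrow> real"
  assumes inj: "inj_on f (ball 0 R)" and f0: "f 0 = 0"
    and derf: "\<And>x. x \<in> ball 0 R \<Longrightarrow> (f has_derivative f' x) (at x)"
    and M0: "M 0 = 0"
    and derM: "\<And>t. 0 \<le> t \<Longrightarrow> t < R \<Longrightarrow> (M has_real_derivative m t) (at t)"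
    and mpos: "\<And>t. 0 \<le> t \<Longrightarrow> t < R \<Longrightarrow> m t > 0"
    and expand: "\<And>x h. x \<in> ball 0 R \<Longrightarrow> m (norm x) * norm h \<le> norm (f' x h)"
    and x: "x \<in> ball 0 R"
  shows "M (norm x) \<le> norm (f x)"
proof (cases "x = 0")
  case True
  then show ?thesis by (simp add: M0)
next
  case False
  define r where "r = norm x"
  have r: "0 < r" "r < R" using False x by (auto simp: r_def)
  have contf: "continuous_on (ball 0 R) f"
    using derf has_derivative_continuous continuous_at_imp_continuous_on by blast
  have sub: "cball 0 r \<subseteq> ball 0 R" "sphere 0 r \<subseteq> ball 0 R" "ball 0 r \<subseteq> ball 0 R" using r by auto
  obtain z where z: "z \<in> sphere 0 r" and zmin: "\<And>y. y \<in> sphere 0 r \<Longrightarrow> norm (f z) \<le> norm (f y)"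
  proof -
    have "continuous_on (sphere 0 r) (\<lambda>y. norm (f y))"
      using contf sub continuous_on_subset by (intro continuous_intros) blast
    moreover have "sphere 0 r \<noteq> ({} :: 'a set)" using r_def by (force simp: set_eq_iff)
    ultimately show ?thesis using continuous_attains_inf[OF compact_sphere] that by metis
  qed
  define w where "w = f z"
  have zR: "z \<in> ball 0 R" and z0: "z \<noteq> 0" using z sub r by auto
  have wmin: "norm w \<le> norm (f x)" using zmin[of x] by (simp add: r_def w_def)
  \<comment> \<open>The image of the open ball is open by invariance of domain, so its frontier lies in the image of the
      sphere, which this connected ball does not meet.\<close>
  have ballsub: "ball 0 (norm w) \<subseteq> f ` ball 0 r"
  proof (rule ccontr)
    assume neg: "\<not> ?thesis"
    have w0: "0 < norm w"
      using neg by fastforce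
    have "0 \<in> ball 0 (norm w) \<inter> f ` ball 0 r" using f0 r w0 by force
    then have "ball 0 (norm w) \<inter> frontier (f ` ball 0 r) \<noteq> {}"
      using neg by (intro connected_Int_frontier) blast+
    then obtain y where y: "norm y < norm w" "y \<in> frontier (f ` ball 0 r)" by auto
    have op: "open (f ` ball 0 r)"
      using contf inj sub by (intro invariance_of_domain) (auto intro: continuous_on_subset inj_on_subset)
    have "compact (f ` cball 0 r)"
      using contf sub by (intro compact_continuous_image) (auto intro: continuous_on_subset)
    then have "closure (f ` ball 0 r) \<subseteq> f ` cball 0 r"
      by (intro closure_minimal) (auto dest: compact_imp_closed)
    then have "y \<in> f ` cball 0 r" "y \<notin> f ` ball 0 r"
      using y op by (auto simp: frontier_def interior_open)
    then have "y \<in> f ` sphere 0 r" by force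
    then show False using zmin y(1) by (force simp: w_def)
  qed
  obtain g where g: "homeomorphism (ball 0 R) (f ` ball 0 R) f g"
    using invariance_of_domain_homeomorphism[OF open_ball contf _ inj] by auto
  have gf: "g (f y) = y" if "y \<in> ball 0 R" for y using g that by (simp add: homeomorphism_def)
  have contg: "continuous_on (f ` ball 0 R) g" using g by (simp add: homeomorphism_def)
  have w0: "w \<noteq> 0" using inj_onD[OF inj, of z 0] f0 z0 zR r by (auto simp: w_def)
  have seg: "t *\<^sub>R w \<in> f ` ball 0 r" if "0 \<le> t" "t < 1" for t
    using that w0 ballsub by (auto simp: mult_less_cancel_right1)
  have segR: "t *\<^sub>R w \<in> f ` ball 0 R" if "0 \<le> t" "t \<le> 1" for t
    using that seg[of t] sub zR by (cases "t = 1") (auto simp: w_def)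
  \<comment> \<open>Differentiability is used on the open interval only, because the norm is not differentiable at
      \<open>g 0 = 0\<close>.\<close>
  define F where "F t = t * norm w - M (norm (g (t *\<^sub>R w)))" for t
  have contM: "continuous_on {0..<R} M"
    using derM DERIV_isCont continuous_at_imp_continuous_on by (metis atLeastLessThan_iff)
  have "F 0 \<le> F 1"
  proof (rule DERIV_nonneg_imp_increasing_open[where f = F and a = 0 and b = 1])
    show "continuous_on {0..1} F"
    proof -
      have "continuous_on {0..1} (\<lambda>t. g (t *\<^sub>R w))"
        by (rule continuous_on_compose2[OF contg]) (use segR in \<open>auto intro!: continuous_intros\<close>)
      then have "continuous_on {0..1} (\<lambda>t. M (norm (g (t *\<^sub>R w))))"
      proof (intro continuous_on_compose2[OF contM] continuous_on_norm)
        show "(\<lambda>t. norm (g (t *\<^sub>R w))) ` {0..1} \<subseteq> {0..<R}" using segR gf by fastforce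
      qed
      then show ?thesis unfolding F_def[abs_def] by (intro continuous_intros)
    qed
  next
    fix t :: real assume t: "0 < t" "t < 1"
    obtain y where y: "y \<in> ball 0 R" "t *\<^sub>R w = f y" using segR[of t] t by auto
    have gy: "g (t *\<^sub>R w) = y" using gf y by auto
    have y0: "y \<noteq> 0" using y(2) f0 w0 t by auto
    have lin: "linear (f' y)" using derf[OF y(1)] has_derivative_linear by blast
    have my: "m (norm y) > 0" using mpos[of "norm y"] y by auto
    have "inj (f' y)"
    proof (rule linear_injective_0[THEN iffD2, OF lin], intro allI impI)
      fix h assume "f' y h = 0"
      then show "h = 0" using expand[OF y(1), of h] my by (simp add: mult_le_0_iff)
    qed
    then obtain g' where g': "f' y \<circ> g' = id"
      using linear_injective_isomorphism[OF lin] by (metis comp_apply eq_id_iff ext)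
    have derg: "(g has_derivative g') (at (t *\<^sub>R w))"
      unfolding y(2)
      by (rule has_derivative_inverse_strong[OF open_ball y(1) contf gf derf[OF y(1)] g'])
    have ling: "linear g'" using derg has_derivative_linear by blast
    have d1: "((\<lambda>s. g (s *\<^sub>R w)) has_derivative (\<lambda>s. g' (s *\<^sub>R w))) (at t)"
      by (rule has_derivative_compose[of "\<lambda>s. s *\<^sub>R w" _ t UNIV g g']) (use derg in \<open>auto intro!: derivative_eq_intros\<close>)
    have d2: "((\<lambda>s. norm (g (s *\<^sub>R w))) has_derivative (\<lambda>s. inner (g' (s *\<^sub>R w)) (sgn y))) (at t)"
      using has_derivative_compose[OF d1, of norm "\<lambda>h. inner h (sgn y)"] has_derivative_norm[OF y0] gy
      by (simp add: inner_commute)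
    have "((\<lambda>s. norm (g (s *\<^sub>R w))) has_real_derivative (inner (g' w) (sgn y))) (at t)"
    proof -
      have "(\<lambda>s. inner (g' (s *\<^sub>R w)) (sgn y)) = (*) (inner (g' w) (sgn y))"
        by (simp add: fun_eq_iff linear_scale[OF ling])
      then show ?thesis using d2 by (simp add: has_field_derivative_def)
    qed
    then have "((\<lambda>s. M (norm (g (s *\<^sub>R w)))) has_real_derivative (m (norm y) * (inner (g' w) (sgn y)))) (at t)"
      using DERIV_chain2[of M "m (norm y)" "\<lambda>s. norm (g (s *\<^sub>R w))" t] derM[of "norm y"] y gy by auto
    then have "(F has_real_derivative (norm w - m (norm y) * (inner (g' w) (sgn y)))) (at t)"
      unfolding F_def by (auto intro!: derivative_eq_intros)
    moreover have "m (norm y) * (inner (g' w) (sgn y)) \<le> norm w"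
    proof -
      have "inner (g' w) (sgn y) \<le> norm (g' w)"
        using norm_cauchy_schwarz[of "g' w" "sgn y"] y0 by (simp add: norm_sgn)
      then have "m (norm y) * (inner (g' w) (sgn y)) \<le> m (norm y) * norm (g' w)"
        using my by simp
      also have "\<dots> \<le> norm (f' y (g' w))" by (rule expand[OF y(1)])
      also have "\<dots> = norm w" using g' by (metis comp_apply id_apply)
      finally show ?thesis .
    qed
    ultimately show "\<exists>d. (F has_real_derivative d) (at t) \<and> d \<ge> 0" by fastforce
  qed simp
  moreover have "F 0 = 0" "F 1 = norm w - M r"
    using gf[of 0] gf[OF zR] f0 r z M0 by (auto simp: F_def w_def)
  ultimately show ?thesis using wmin r_def by simp
qed

section \<open>Distortion of starlike functions\<close>

text \<open>
  The function \<open>q = (p - \<gamma>) / (1 - \<gamma>)\<close> maps the disc into the right half-plane and \<open>0\<close> to \<open>1\<close>; followed by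
  the Cayley transform \<open>q \<mapsto> (q - 1) / (q + 1)\<close> it fulfils the hypotheses of the Schwarz lemma. The disc
  \<open>norm a \<le> norm z\<close> is then transported back by \<open>a \<mapsto> (1 + a) / (1 - a)\<close>.
\<close>

lemma caratheodory_bounds:
  assumes hol: "p holomorphic_on ball 0 1" and p0: "p 0 = 1"
    and re: "\<And>z. z \<in> ball 0 1 \<Longrightarrow> Re (p z) > \<gamma>" and z: "z \<in> ball 0 1"
  shows "norm (p z - of_real \<gamma>) \<le> (1 - \<gamma>) * ((1 + norm z) / (1 - norm z))"
    and "Re (p z) \<ge> \<gamma> + (1 - \<gamma>) * ((1 - norm z) / (1 + norm z))"
proof -
  have g1: "\<gamma> < 1" using re[of 0] p0 by simp
  define q where "q w = (p w - of_real \<gamma>) / of_real (1 - \<gamma>)" for w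
  define s where "s w = (q w - 1) / (q w + 1)" for w
  have rq: "Re (q w) > 0" if "w \<in> ball 0 1" for w
    using re[OF that] g1 by (simp add: q_def Re_divide_of_real)
  have nz: "q w + 1 \<noteq> 0" if "w \<in> ball 0 1" for w
    using rq[OF that] by (auto simp: complex_eq_iff)
  have "norm (s z) \<le> norm z"
  proof (rule Schwarz_Lemma(1))
    show "s holomorphic_on ball 0 1"
      unfolding s_def using nz g1 unfolding q_def by (intro holomorphic_intros hol) auto
    show "s 0 = 0" using g1 p0 by (simp add: s_def q_def field_simps)
    show "norm z < 1" using z by simp
    fix w :: complex assume w: "norm w < 1"
    have "norm (q w - 1) < norm (q w + 1)"
      using rq[of w] w by (simp add: cmod_def real_sqrt_less_iff power2_eq_square algebra_simps)
    then show "norm (s w) < 1" using nz[of w] w by (simp add: s_def norm_divide)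
  qed
  define a where "a = s z"
  have a: "norm a \<le> norm z" "norm z < 1" using \<open>norm (s z) \<le> norm z\<close> z by (auto simp: a_def)
  have a1: "1 - a \<noteq> 0" using a by auto
  have qa: "q z = (1 + a) / (1 - a)"
  proof -
    have "a * (q z + 1) = q z - 1" using nz[OF z] by (simp add: a_def s_def)
    then show ?thesis using a1 by (simp add: eq_divide_eq algebra_simps)
  qed
  have "norm (1 + a) \<le> 1 + norm z" using norm_triangle_ineq[of 1 a] a by simp
  moreover have n1a: "norm (1 - a) \<ge> 1 - norm z" using norm_triangle_ineq2[of 1 a] a by simp
  ultimately have qn: "norm (q z) \<le> (1 + norm z) / (1 - norm z)"
    using a by (simp add: qa norm_divide frac_le)
  have "Re (q z) = (1 - (norm a)\<^sup>2) / (norm (1 - a))\<^sup>2"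
    by (simp add: qa Re_divide cmod_power2) (simp add: power2_eq_square algebra_simps)
  also have "\<dots> \<ge> (1 - (norm a)\<^sup>2) / (1 + norm a)\<^sup>2"
  proof (rule divide_left_mono)
    show "(norm (1 - a))\<^sup>2 \<le> (1 + norm a)\<^sup>2" using norm_triangle_ineq4[of 1 a] by simp
    show "0 \<le> 1 - (norm a)\<^sup>2" using a by (simp add: power_le_one)
    show "0 < (1 + norm a)\<^sup>2 * (cmod (1 - a))\<^sup>2" using a1 norm_ge_zero[of a] by (intro mult_pos_pos zero_less_power add_pos_nonneg) auto
  qed
  finally have "(1 - (norm a)\<^sup>2) / (1 + norm a)\<^sup>2 \<le> Re (q z)" .
  moreover have "(1 - (norm a)\<^sup>2) / (1 + norm a)\<^sup>2 = (1 - norm a) / (1 + norm a)"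
    by (simp add: divide_simps) (auto simp: power2_eq_square algebra_simps)
  moreover have "(1 - norm z) / (1 + norm z) \<le> (1 - norm a) / (1 + norm a)"
    using a norm_ge_zero[of a] by (intro frac_le) linarith+
  ultimately have qr: "Re (q z) \<ge> (1 - norm z) / (1 + norm z)" by linarith
  have pq: "p z = of_real \<gamma> + of_real (1 - \<gamma>) * q z" using g1 by (simp add: q_def)
  have "norm (p z - of_real \<gamma>) = (1 - \<gamma>) * norm (q z)"
    unfolding pq using g1 by (simp add: norm_mult del: of_real_diff)
  then show "norm (p z - of_real \<gamma>) \<le> (1 - \<gamma>) * ((1 + norm z) / (1 - norm z))"
    using mult_left_mono[OF qn, of "1 - \<gamma>"] g1 by simp
  have "Re (p z) = \<gamma> + (1 - \<gamma>) * Re (q z)" unfolding pq by simp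
  then show "Re (p z) \<ge> \<gamma> + (1 - \<gamma>) * ((1 - norm z) / (1 + norm z))"
    using mult_left_mono[OF qr, of "1 - \<gamma>"] g1 by simp
qed

text \<open>
  With a holomorphic logarithm \<open>g\<close> of \<open>h\<close>, the function \<open>P = 1 + z g'\<close> has real part above \<open>1 - c\<close> and
  \<open>P 0 = 1\<close>. The Caratheodory bounds for \<open>P\<close> at \<open>t z\<close> say that the derivative of \<open>t \<mapsto> Re (g (t z))\<close>
  lies between those of \<open>- 2 c ln (1 + t r)\<close> and \<open>- 2 c ln (1 - t r)\<close>, and all three functions vanish at \<open>t = 0\<close>.
\<close>

lemma log_norm_growth:
  assumes hol: "h holomorphic_on ball 0 1" and h0: "h 0 = 1"
    and nz: "\<And>z. z \<in> ball 0 1 \<Longrightarrow> h z \<noteq> 0"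
    and re: "\<And>z. z \<in> ball 0 1 \<Longrightarrow> Re (z * deriv h z / h z) > - c"
    and z: "z \<in> ball 0 1"
  shows "norm (h z) \<le> (1 - norm z) powr (- 2 * c)"
    and "norm (h z) \<ge> (1 + norm z) powr (- 2 * c)"
proof -
  define r where "r = norm z"
  have r: "0 \<le> r" "r < 1" using z by (auto simp: r_def)
  obtain g where holg: "g holomorphic_on ball 0 1" and g: "\<And>x. x \<in> ball 0 1 \<Longrightarrow> exp (g x) = h x"
    using holomorphic_logarithm_exists[of "ball 0 1" h 0] hol nz by auto
  have dg: "deriv g w = deriv h w / h w" if w: "w \<in> ball 0 1" for w
  proof -
    have "((\<lambda>x. exp (g x)) has_field_derivative (exp (g w) * deriv g w)) (at w)"
      by (intro DERIV_chain2[OF DERIV_exp] holomorphic_derivI[OF holg open_ball w])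
    then have "(h has_field_derivative (exp (g w) * deriv g w)) (at w)"
      by (rule has_field_derivative_transform_within_open[OF _ open_ball w]) (use g in auto)
    then show ?thesis using g[OF w] nz[OF w] by (simp add: DERIV_imp_deriv)
  qed
  define P where "P w = 1 + w * deriv g w" for w
  have holP: "P holomorphic_on ball 0 1"
    unfolding P_def by (intro holomorphic_intros holomorphic_deriv holg) auto
  have reP: "Re (P w) > 1 - c" if "w \<in> ball 0 1" for w
    using re[OF that] dg[OF that] by (simp add: P_def)
  define L where "L t = Re (g (of_real t * z))" for t :: real
  have tz: "of_real t * z \<in> ball 0 1" if "0 \<le> t" "t \<le> 1" for t :: real
    using that r mult_left_le_one_le[of r t] by (simp add: norm_mult r_def)
  have dL: "(L has_real_derivative Re (z * deriv g (of_real t * z))) (at t)" if t: "0 \<le> t" "t \<le> 1" for t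
  proof -
    have "((\<lambda>t. of_real t * z) has_vector_derivative z) (at t)"
      by (auto intro!: derivative_eq_intros)
    then have "((\<lambda>t. g (of_real t * z)) has_vector_derivative z * deriv g (of_real t * z)) (at t)"
      using field_vector_diff_chain_at[of "\<lambda>t. of_real t * z" z t g]
        holomorphic_derivI[OF holg open_ball tz[OF t], of UNIV]
      by (simp add: o_def)
    then have "((\<lambda>t. Re (g (of_real t * z))) has_vector_derivative Re (z * deriv g (of_real t * z))) (at t)"
      by (rule bounded_linear.has_vector_derivative[OF bounded_linear_Re])
    then show ?thesis by (simp add: L_def[abs_def] has_real_derivative_iff_has_vector_derivative)
  qed
  have contL: "continuous_on {0..1} L"
    by (intro DERIV_atLeastAtMost_imp_continuous_on) (use dL in auto)
  have tL: "t * Re (z * deriv g (of_real t * z)) = Re (P (of_real t * z)) - 1" for t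
    by (simp add: P_def algebra_simps)
  have L0: "L 0 = 0" using g[of 0] h0 by (metis L_def ball_trivial centre_in_ball exp_eq_1 mult_zero_left of_real_0 zero_less_one)
  have P0: "P 0 = 1" by (simp add: P_def)
  have tr: "t * r < 1" if "0 < t" "t < 1" for t
    using that r by (metis mult_left_le_one_le order.strict_trans1 less_imp_le)
  have L1: "norm (h z) = exp (L 1)" using g[OF z] by (simp add: L_def flip: norm_exp_eq_Re)
  have "- 2 * c * ln (1 - 0 * r) - L 0 \<le> - 2 * c * ln (1 - 1 * r) - L 1"
  proof (rule DERIV_nonneg_imp_increasing_open[where f = "\<lambda>t. - 2 * c * ln (1 - t * r) - L t" and a = 0 and b = 1])
    show "continuous_on {0..1} (\<lambda>t. - 2 * c * ln (1 - t * r) - L t)"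
      using r mult_left_le_one_le[of r] by (intro continuous_intros contL) force
  next
    fix t :: real assume t: "0 < t" "t < 1"
    have "Re (P (of_real t * z)) - (1 - c) \<le> c * ((1 + t * r) / (1 - t * r))"
      using caratheodory_bounds(1)[OF holP P0 reP tz[of t]] t
        complex_Re_le_cmod[of "P (of_real t * z) - of_real (1 - c)"]
      by (simp add: norm_mult r_def)
    also have "\<dots> = c + t * (2 * c * r / (1 - t * r))"
      using tr[OF t] by (simp add: field_simps)
    finally have "t * Re (z * deriv g (of_real t * z)) \<le> t * (2 * c * r / (1 - t * r))"
      unfolding tL by simp
    then have "Re (z * deriv g (of_real t * z)) \<le> 2 * c * r / (1 - t * r)"
      using t by (simp only: mult_le_cancel_left_pos)
    moreover have "((\<lambda>t. - 2 * c * ln (1 - t * r) - L t) has_real_derivative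
        2 * c * r / (1 - t * r) - Re (z * deriv g (of_real t * z))) (at t)"
      using tr[OF t] t dL[of t] by (auto intro!: derivative_eq_intros simp: field_simps)
    ultimately show "\<exists>y. ((\<lambda>t. - 2 * c * ln (1 - t * r) - L t) has_real_derivative y) (at t) \<and> 0 \<le> y"
      by fastforce
  qed simp
  then show "norm (h z) \<le> (1 - norm z) powr (- 2 * c)"
    using L1 L0 r by (simp add: powr_def r_def)
  have "L 0 + 2 * c * ln (1 + 0 * r) \<le> L 1 + 2 * c * ln (1 + 1 * r)"
  proof (rule DERIV_nonneg_imp_increasing_open[where f = "\<lambda>t. L t + 2 * c * ln (1 + t * r)" and a = 0 and b = 1])
    show "continuous_on {0..1} (\<lambda>t. L t + 2 * c * ln (1 + t * r))"
      using r by (intro continuous_intros contL) (auto simp: add_nonneg_eq_0_iff)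
  next
    fix t :: real assume t: "0 < t" "t < 1"
    have p: "1 + t * r > 0" using t r by (simp add: add_pos_nonneg)
    have "(1 - c) + c * ((1 - t * r) / (1 + t * r)) \<le> Re (P (of_real t * z))"
      using caratheodory_bounds(2)[OF holP P0 reP tz[of t]] t
      by (simp add: norm_mult r_def)
    moreover have "(1 - c) + c * ((1 - t * r) / (1 + t * r)) = 1 - t * (2 * c * r / (1 + t * r))"
      using p by (simp add: field_simps)
    ultimately have "t * - (2 * c * r / (1 + t * r)) \<le> t * Re (z * deriv g (of_real t * z))"
      unfolding tL by simp
    then have "- (2 * c * r / (1 + t * r)) \<le> Re (z * deriv g (of_real t * z))"
      using t by (simp only: mult_le_cancel_left_pos)
    moreover have "((\<lambda>t. L t + 2 * c * ln (1 + t * r)) has_real_derivative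
        Re (z * deriv g (of_real t * z)) + 2 * c * r / (1 + t * r)) (at t)"
      using p t dL[of t] by (auto intro!: derivative_eq_intros simp: field_simps)
    ultimately show "\<exists>y. ((\<lambda>t. L t + 2 * c * ln (1 + t * r)) has_real_derivative y) (at t) \<and> 0 \<le> y"
      by fastforce
  qed simp
  then show "norm (h z) \<ge> (1 + norm z) powr (- 2 * c)"
    using L1 L0 r by (simp add: powr_def r_def)
qed

text \<open>
  Writing \<open>\<phi> z = z h z\<close> gives \<open>z \<phi>' / \<phi> = 1 + z h' / h\<close>, so starlikeness of order \<open>\<beta>\<close> is the hypothesis of
  \<open>log_norm_growth\<close> with \<open>c = 1 - \<beta>\<close>.
\<close>

lemma starlike_quotient:
  assumes phi: "\<phi> \<in> starlike_class \<beta>" and b: "\<beta> < 1"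
  obtains h where "h holomorphic_on ball 0 1" "h 0 = 1" "\<And>z. z \<in> ball 0 1 \<Longrightarrow> \<phi> z = z * h z"
    "\<And>z. z \<in> ball 0 1 \<Longrightarrow> h z \<noteq> 0"
    "\<And>z. z \<in> ball 0 1 \<Longrightarrow> norm (h z) \<le> (1 - norm z) powr (- 2 * (1 - \<beta>))"
    "\<And>z. z \<in> ball 0 1 \<Longrightarrow> norm (h z) \<ge> (1 + norm z) powr (- 2 * (1 - \<beta>))"
proof -
  have hol: "\<phi> holomorphic_on ball 0 1" and phi0: "\<phi> 0 = 0" and dphi0: "deriv \<phi> 0 = 1"
    and star: "\<And>z. z \<in> ball 0 1 \<Longrightarrow> z \<noteq> 0 \<Longrightarrow> \<phi> z \<noteq> 0 \<and> Re (z * deriv \<phi> z / \<phi> z) > \<beta>"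
    using phi by (auto simp: starlike_class_def)
  define h where "h z = (if z = 0 then 1 else \<phi> z / z)" for z
  have holh: "h holomorphic_on ball 0 1"
    by (rule pole_theorem_open_0[OF hol, of 0]) (auto simp: h_def phi0 dphi0)
  have eq: "\<phi> z = z * h z" for z by (simp add: h_def phi0)
  have nz: "h z \<noteq> 0" if "z \<in> ball 0 1" for z using star[OF that] by (simp add: h_def)
  have re: "Re (z * deriv h z / h z) > - (1 - \<beta>)" if z: "z \<in> ball 0 1" for z
  proof (cases "z = 0")
    case True
    then show ?thesis using b by simp
  next
    case False
    have "((\<lambda>w. w * h w) has_field_derivative (h z + z * deriv h z)) (at z)"
      using holomorphic_derivI[OF holh open_ball z] by (auto intro!: derivative_eq_intros)
    then have "deriv \<phi> z = h z + z * deriv h z"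
      using eq by (metis DERIV_imp_deriv ext)
    then have "z * deriv \<phi> z / \<phi> z = 1 + z * deriv h z / h z"
      using False nz[OF z] by (simp add: eq field_simps)
    then show ?thesis using star[OF z False] by simp
  qed
  show ?thesis
    using that[OF holh _ _ nz log_norm_growth[OF holh _ nz re]] eq by (simp add: h_def)
qed

text \<open>
  Since \<open>\<mu>\<^sup>- \<^sup>v \<phi> (\<mu>\<^sup>v z) = z h (\<mu>\<^sup>v z)\<close>, the quotient is the reciprocal of a product of \<open>k\<close> values of
  \<open>h\<close> at points of modulus \<open>norm z\<close>. Each factor contributes the exponent \<open>- 2 / k\<close>.
\<close>

lemma rotation_quotient_bounds:
  assumes k: "k > 0" and phi: "\<phi> \<in> starlike_class ((real k - 1) / real k)"
  shows "rotation_quotient k \<phi> holomorphic_on ball 0 1"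
    and "z \<in> ball 0 1 \<Longrightarrow> norm (rotation_quotient k \<phi> z) \<ge> (1 - norm z)\<^sup>2"
    and "z \<in> ball 0 1 \<Longrightarrow> norm (rotation_quotient k \<phi> z) \<le> (1 + norm z)\<^sup>2"
proof -
  have b: "(real k - 1) / real k < 1" "1 - (real k - 1) / real k = 1 / real k"
    using k by (auto simp: field_simps)
  obtain h where h: "h holomorphic_on ball 0 1" "h 0 = 1" "\<And>z. z \<in> ball 0 1 \<Longrightarrow> \<phi> z = z * h z"
    "\<And>z. z \<in> ball 0 1 \<Longrightarrow> h z \<noteq> 0"
    "\<And>z. z \<in> ball 0 1 \<Longrightarrow> norm (h z) \<le> (1 - norm z) powr (- 2 * (1 / real k))"
    "\<And>z. z \<in> ball 0 1 \<Longrightarrow> norm (h z) \<ge> (1 + norm z) powr (- 2 * (1 / real k))"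
    using starlike_quotient[OF phi b(1), unfolded b(2)] by blast
  define \<mu> where "\<mu> = exp (2 * of_real pi * \<i> / of_nat k)"
  have mu: "norm \<mu> = 1" "\<mu> \<noteq> 0" by (auto simp: \<mu>_def norm_exp_eq_Re)
  have rot: "\<mu> ^ v * z \<in> ball 0 1" "norm (\<mu> ^ v * z) = norm z" if "z \<in> ball 0 1" for v z
    using that mu by (auto simp: norm_mult norm_power)
  define H where "H z = (\<Prod>v<k. h (\<mu> ^ v * z))" for z
  have Q: "rotation_quotient k \<phi> z = 1 / H z" if z: "z \<in> ball 0 1" for z
  proof (cases "z = 0")
    case False
    have "rotation_product k \<phi> z = (\<Prod>v<k. z * h (\<mu> ^ v * z))"
      unfolding rotation_product_def Let_def \<mu>_def[symmetric]
      using h(3)[OF rot(1)[OF z]] mu by (intro prod.cong) (auto simp: power_int_minus)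
    also have "\<dots> = z ^ k * H z" by (simp add: prod.distrib H_def)
    finally show ?thesis using False by (simp add: rotation_quotient_def)
  qed (simp add: rotation_quotient_def H_def h)
  have "(\<lambda>z. 1 / H z) holomorphic_on ball 0 1"
    unfolding H_def using h(4) rot(1)
    by (intro holomorphic_intros holomorphic_on_compose_gen[OF _ h(1), unfolded o_def]) auto
  then show "rotation_quotient k \<phi> holomorphic_on ball 0 1"
    by (rule holomorphic_transform) (use Q in auto)
  assume z: "z \<in> ball 0 1"
  have pw: "(x powr (- 2 * (1 / real k))) ^ k = inverse (x\<^sup>2)" if "x > 0" for x
  proof -
    have "(x powr (- 2 * (1 / real k))) ^ k = x powr (- 2 * (1 / real k) * real k)"
      using that by (simp only: powr_powr powr_realpow[symmetric] powr_gt_zero)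
    also have "\<dots> = x powr (- 2)" using k by simp
    finally show ?thesis using that by (simp add: powr_minus)
  qed
  have nH: "norm (H z) = (\<Prod>v<k. norm (h (\<mu> ^ v * z)))" by (simp add: H_def prod_norm)
  have "norm (H z) \<le> (\<Prod>v<k. (1 - norm z) powr (- 2 * (1 / real k)))"
    unfolding nH using h(5)[OF rot(1)[OF z]] rot(2)[OF z] by (intro prod_mono) auto
  then have up: "norm (H z) \<le> inverse ((1 - norm z)\<^sup>2)" using pw[of "1 - norm z"] z by simp
  have "norm (H z) \<ge> (\<Prod>v<k. (1 + norm z) powr (- 2 * (1 / real k)))"
    unfolding nH using h(6)[OF rot(1)[OF z]] rot(2)[OF z] by (intro prod_mono) auto
  then have lo: "norm (H z) \<ge> inverse ((1 + norm z)\<^sup>2)" using pw[of "1 + norm z"] by (simp add: add_pos_nonneg)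
  have H0: "norm (H z) > 0" using h(4)[OF rot(1)[OF z]] by (simp add: H_def)
  show "norm (rotation_quotient k \<phi> z) \<ge> (1 - norm z)\<^sup>2"
    using le_imp_inverse_le[OF up H0] by (simp add: Q[OF z] norm_divide inverse_eq_divide)
  have pos: "1 + norm z > 0" using norm_ge_zero[of z] by linarith
  show "norm (rotation_quotient k \<phi> z) \<le> (1 + norm z)\<^sup>2"
    using le_imp_inverse_le[OF lo] pos by (simp add: Q[OF z] norm_divide inverse_eq_divide add_pos_nonneg)
qed

section \<open>The extremal function in closed form\<close>

text \<open>
  The convex combination of the Koebe function \<open>z / (1 - z)\<^sup>2\<close> and the half-plane map \<open>z / (1 - z)\<close>. It is used
  over the complex numbers, where it is the extremal function, and over the reals, where it gives the bounds.
\<close>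

definition koebe_mix :: "real \<Rightarrow> 'a \<Rightarrow> 'a::real_normed_field" where
  "koebe_mix \<gamma> z = of_real (1 - \<gamma>) * (z / (1 - z)\<^sup>2) + of_real \<gamma> * (z / (1 - z))"

text \<open>
  Kept in factored form so that the factor \<open>\<gamma> + (1 - \<gamma>) (1 + z) / (1 - z)\<close> of the Caratheodory bounds and the
  factor \<open>1 / (1 - z)\<^sup>2\<close> of the starlike distortion remain visible.
\<close>

definition koebe_mix_deriv :: "real \<Rightarrow> 'a \<Rightarrow> 'a::real_normed_field" where
  "koebe_mix_deriv \<gamma> z = (of_real \<gamma> + of_real (1 - \<gamma>) * ((1 + z) / (1 - z))) / (1 - z)\<^sup>2"

lemma koebe_mix_0 [simp]: "koebe_mix \<gamma> 0 = 0"
  by (simp add: koebe_mix_def)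

lemma has_field_derivative_koebe_mix:
  assumes "z \<noteq> 1"
  shows "(koebe_mix \<gamma> has_field_derivative koebe_mix_deriv \<gamma> z) (at z)"
proof -
  have nz: "1 - z \<noteq> 0" using assms by simp
  have 1: "((\<lambda>z. z / (1 - z)\<^sup>2) has_field_derivative (1 + z) / (1 - z) / (1 - z)\<^sup>2) (at z)"
    using nz by (auto intro!: derivative_eq_intros simp: divide_simps) (simp add: eval_nat_numeral algebra_simps)
  have 2: "((\<lambda>z. z / (1 - z)) has_field_derivative 1 / (1 - z)\<^sup>2) (at z)"
    using nz by (auto intro!: derivative_eq_intros simp: divide_simps power2_eq_square)
  have "koebe_mix_deriv \<gamma> z =
      of_real (1 - \<gamma>) * ((1 + z) / (1 - z) / (1 - z)\<^sup>2) + of_real \<gamma> * (1 / (1 - z)\<^sup>2)"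
    unfolding koebe_mix_deriv_def add_divide_distrib[of "of_real \<gamma>"] by simp
  then show ?thesis
    unfolding koebe_mix_def[abs_def] by (simp only:) (intro DERIV_add DERIV_cmult 1 2)
qed

text \<open>
  The series is \<open>z\<close> times a combination of the geometric series and its derivative; the term of index \<open>1\<close>
  is the summand \<open>z\<close>, as its coefficient is \<open>(1 - \<gamma>) + \<gamma> = 1\<close>.
\<close>

lemma koebe_mix_infsum:
  fixes z :: "'a::{real_normed_field, banach}"
  assumes z: "norm z < 1"
  shows "z + (\<Sum>\<^sub>\<infinity>m\<in>{2..}. of_real (real m * (1 - \<gamma>) + \<gamma>) * z ^ m) = koebe_mix \<gamma> z"
proof -
  define c where "c m = of_real (real m * (1 - \<gamma>) + \<gamma>) * z ^ m" for m
  have nz: "1 - z \<noteq> 0" using z by auto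
  have ceq: "z * (of_real (1 - \<gamma>) * (of_nat (Suc n) * x ^ n) + of_real \<gamma> * x ^ n)
      = of_real (real (Suc n) * (1 - \<gamma>) + \<gamma>) * (z * x ^ n)" for n and x :: 'a
  proof -
    have "(of_real (real (Suc n) * (1 - \<gamma>) + \<gamma>) :: 'a) = of_nat (Suc n) * of_real (1 - \<gamma>) + of_real \<gamma>"
      by (simp only: of_real_add of_real_mult of_real_of_nat_eq)
    then show ?thesis by (simp only: ring_distribs mult_ac)
  qed
  have "(\<lambda>n. z * (of_real (1 - \<gamma>) * (of_nat (Suc n) * z ^ n) + of_real \<gamma> * z ^ n)) sums
      (z * (of_real (1 - \<gamma>) * (1 / (1 - z)\<^sup>2) + of_real \<gamma> * (1 / (1 - z))))"
    by (intro sums_mult sums_add geometric_deriv_sums geometric_sums z)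
  also have "(\<lambda>n. z * (of_real (1 - \<gamma>) * (of_nat (Suc n) * z ^ n) + of_real \<gamma> * z ^ n)) = (\<lambda>n. c (Suc n))"
    by (simp only: ceq) (simp add: c_def)
  also have "z * (of_real (1 - \<gamma>) * (1 / (1 - z)\<^sup>2) + of_real \<gamma> * (1 / (1 - z))) = koebe_mix \<gamma> z"
    by (simp add: koebe_mix_def algebra_simps)
  finally have s: "(\<lambda>n. c (Suc n)) sums koebe_mix \<gamma> z" .
  have abs: "summable (\<lambda>n. norm (c (Suc n)))"
  proof (rule summable_comparison_test')
    have "norm (norm z) < 1" using z by simp
    from sums_summable[OF geometric_deriv_sums[OF this]] summable_geometric[OF this]
    show "summable (\<lambda>n. \<bar>1 - \<gamma>\<bar> * (real (Suc n) * norm z ^ n) + \<bar>\<gamma>\<bar> * norm z ^ n)"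
      by (intro summable_add summable_mult) auto
    fix n :: nat
    have "norm (c (Suc n)) \<le> (real (Suc n) * \<bar>1 - \<gamma>\<bar> + \<bar>\<gamma>\<bar>) * (norm z * norm z ^ n)"
      unfolding c_def norm_mult norm_power norm_of_real power_Suc
      by (intro mult_right_mono order.trans[OF abs_triangle_ineq]) (auto simp: abs_mult)
    also have "\<dots> \<le> (real (Suc n) * \<bar>1 - \<gamma>\<bar> + \<bar>\<gamma>\<bar>) * (1 * norm z ^ n)"
      using z by (intro mult_left_mono mult_right_mono) auto
    finally show "norm (norm (c (Suc n))) \<le> \<bar>1 - \<gamma>\<bar> * (real (Suc n) * norm z ^ n) + \<bar>\<gamma>\<bar> * norm z ^ n"
      by (simp add: algebra_simps)
  qed
  have "(\<lambda>n. c (Suc (Suc n))) sums (koebe_mix \<gamma> z - c (Suc 0))"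
    using s sums_Suc_iff[of "\<lambda>n. c (Suc n)"] by simp
  moreover have "summable (\<lambda>n. norm (c (Suc (Suc n))))"
    using abs by (subst summable_Suc_iff)
  ultimately have "((\<lambda>n. c (Suc (Suc n))) has_sum (koebe_mix \<gamma> z - c (Suc 0))) UNIV"
    by (intro norm_summable_imp_has_sum)
  then have "(c has_sum (koebe_mix \<gamma> z - c (Suc 0))) {2..}"
  proof -
    have "bij_betw (\<lambda>n. Suc (Suc n)) UNIV {2..}"
      by (rule bij_betwI[where g = "\<lambda>m. m - 2"]) auto
    from has_sum_reindex_bij_betw[OF this, of c] show ?thesis
      using \<open>((\<lambda>n. c (Suc (Suc n))) has_sum _) UNIV\<close> by simp
  qed
  then have "infsum c {2..} = koebe_mix \<gamma> z - c (Suc 0)" by (rule infsumI)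
  then show ?thesis by (simp add: c_def[abs_def])
qed

text \<open>
  The alternating series arises from the other one by \<open>r \<mapsto> - r\<close> and a change of sign.
\<close>

lemma koebe_mix_infsum_real:
  assumes "0 \<le> r" "r < 1"
  shows "r + (\<Sum>\<^sub>\<infinity>m\<in>{2..}. (real m * (1 - \<gamma>) + \<gamma>) * r ^ m) = koebe_mix \<gamma> r"
    and "r + (\<Sum>\<^sub>\<infinity>m\<in>{2..}. (-1) ^ (m - 1) * (real m * (1 - \<gamma>) + \<gamma>) * r ^ m) = - koebe_mix \<gamma> (- r)"
proof -
  show "r + (\<Sum>\<^sub>\<infinity>m\<in>{2..}. (real m * (1 - \<gamma>) + \<gamma>) * r ^ m) = koebe_mix \<gamma> r"
    using koebe_mix_infsum[of r \<gamma>] assms by simp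
  have "(-1) ^ (m - 1) * (real m * (1 - \<gamma>) + \<gamma>) * r ^ m = - ((real m * (1 - \<gamma>) + \<gamma>) * (- r) ^ m)"
    if m: "m \<in> {2..}" for m
  proof -
    obtain n where "m = Suc n" using m by (cases m) auto
    then show ?thesis by (simp add: power_minus[of r])
  qed
  then have "(\<Sum>\<^sub>\<infinity>m\<in>{2..}. (-1) ^ (m - 1) * (real m * (1 - \<gamma>) + \<gamma>) * r ^ m) =
      - (\<Sum>\<^sub>\<infinity>m\<in>{2..}. (real m * (1 - \<gamma>) + \<gamma>) * (- r) ^ m)"
    by (subst infsum_uminus[symmetric]) (intro infsum_cong, auto)
  then show "r + (\<Sum>\<^sub>\<infinity>m\<in>{2..}. (-1) ^ (m - 1) * (real m * (1 - \<gamma>) + \<gamma>) * r ^ m) = - koebe_mix \<gamma> (- r)"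
    using koebe_mix_infsum[of "- r" \<gamma>] assms by simp
qed

section \<open>Bounds for close-to-convex harmonic maps\<close>

lemma unimodular_rotation:
  fixes b s :: complex
  assumes "norm s = 1"
  obtains e where "norm e = 1" "e * b = of_real (norm b) * s"
proof (cases "b = 0")
  case False
  have "cnj (sgn b) * b = of_real (norm b)"
    using False by (simp add: sgn_eq complex_norm_square[symmetric] power2_eq_square mult.commute[of "cnj b"])
  then show ?thesis
    using that[of "s * cnj (sgn b)"] assms False by (simp add: norm_mult norm_sgn mult.assoc mult.commute)
qed (use that[of 1] in simp)

text \<open>
  Put \<open>a = Q u'\<close> and \<open>b = Q v'\<close> at the point \<open>z\<close>. The Caratheodory bounds hold for \<open>a + \<epsilon> b\<close> with every unimodular
  \<open>\<epsilon>\<close>. For the upper bound \<open>\<epsilon> b\<close> is rotated into the direction of \<open>a\<close>, for the lower bound onto the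
  negative real axis; the bounds on \<open>\<bar>Q\<bar>\<close> finish both.
\<close>

lemma close_to_convex_derivative_bounds:
  fixes \<gamma> :: real
  assumes k: "k > 0" and g: "0 \<le> \<gamma>" "\<gamma> < 1"
    and phi: "\<phi> \<in> starlike_class ((real k - 1) / real k)"
    and dec: "harmonic_decomposition f u v"
    and re: "\<And>z. z \<in> ball 0 1 \<Longrightarrow> Re (rotation_quotient k \<phi> z * deriv u z - of_real \<gamma>)
                        > norm (rotation_quotient k \<phi> z * deriv v z)"
    and z: "z \<in> ball 0 1"
  shows "norm (deriv u z) + norm (deriv v z) \<le> koebe_mix_deriv \<gamma> (norm z)"
    and "norm (deriv u z) - norm (deriv v z) \<ge> koebe_mix_deriv \<gamma> (- norm z)"
proof -
  define Q where "Q = rotation_quotient k \<phi>"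
  define a b where "a = Q z * deriv u z" and "b = Q z * deriv v z"
  note Q = rotation_quotient_bounds[OF k phi, folded Q_def]
  have u: "u holomorphic_on ball 0 1" "v holomorphic_on ball 0 1" "deriv u 0 = 1" "deriv v 0 = 0"
    using dec by (auto simp: harmonic_decomposition_def)
  have Q0: "Q 0 = 1" by (simp add: Q_def rotation_quotient_def)
  have z1: "norm z < 1" "1 + norm z > 0" using z norm_ge_zero[of z] by (simp, linarith)
  have *: "norm (a + e * b - of_real \<gamma>) \<le> (1 - \<gamma>) * ((1 + norm z) / (1 - norm z))"
      "Re (a + e * b) \<ge> \<gamma> + (1 - \<gamma>) * ((1 - norm z) / (1 + norm z))" if e: "norm e = 1" for e
  proof -
    define P where "P w = Q w * (deriv u w + e * deriv v w)" for w
    have "P holomorphic_on ball 0 1"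
      unfolding P_def by (intro holomorphic_intros holomorphic_deriv u Q(1)) auto
    moreover have "P 0 = 1" by (simp add: P_def Q0 u)
    moreover have "Re (P w) > \<gamma>" if w: "w \<in> ball 0 1" for w
    proof -
      have "P w = Q w * deriv u w + e * (Q w * deriv v w)" by (simp add: P_def algebra_simps)
      moreover have "- Re (e * (Q w * deriv v w)) \<le> norm (Q w * deriv v w)"
        using complex_Re_le_cmod[of "- (e * (Q w * deriv v w))"] e by (simp add: norm_mult)
      ultimately show ?thesis using re[OF w] by (simp add: Q_def)
    qed
    ultimately have "norm (P z - of_real \<gamma>) \<le> (1 - \<gamma>) * ((1 + norm z) / (1 - norm z))"
      "Re (P z) \<ge> \<gamma> + (1 - \<gamma>) * ((1 - norm z) / (1 + norm z))"
      using caratheodory_bounds[OF _ _ _ z] by auto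
    moreover have "P z = a + e * b" by (simp add: P_def a_def b_def algebra_simps)
    ultimately show "norm (a + e * b - of_real \<gamma>) \<le> (1 - \<gamma>) * ((1 + norm z) / (1 - norm z))"
      "Re (a + e * b) \<ge> \<gamma> + (1 - \<gamma>) * ((1 - norm z) / (1 + norm z))" by simp_all
  qed
  define U where "U = \<gamma> + (1 - \<gamma>) * ((1 + norm z) / (1 - norm z))"
  define L where "L = \<gamma> + (1 - \<gamma>) * ((1 - norm z) / (1 + norm z))"
  have L0: "L > 0" using g z1 by (auto simp: L_def intro!: add_nonneg_pos divide_pos_pos)
  have "norm a + norm b \<le> U"
  proof -
    define s where "s = (if a = 0 then 1 else sgn a)"
    have s: "norm s = 1" by (simp add: s_def norm_sgn)
    have as: "a = of_real (norm a) * s" by (simp add: s_def sgn_eq)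
    obtain e where e: "norm e = 1" "e * b = of_real (norm b) * s" using unimodular_rotation[OF s] .
    have "a + e * b = of_real (norm a + norm b) * s" using as e(2) by (simp add: algebra_simps)
    then have "norm (a + e * b) = norm a + norm b" using s by (simp add: norm_mult del: of_real_add)
    moreover have "norm (a + e * b) \<le> \<gamma> + norm (a + e * b - of_real \<gamma>)"
      using norm_triangle_ineq[of "of_real \<gamma>" "a + e * b - of_real \<gamma>"] g by simp
    ultimately show ?thesis using *(1)[OF e(1)] by (simp add: U_def)
  qed
  then have up: "norm (Q z) * (norm (deriv u z) + norm (deriv v z)) \<le> U"
    by (simp add: a_def b_def norm_mult algebra_simps)
  have "(1 - norm z)\<^sup>2 * (norm (deriv u z) + norm (deriv v z)) \<le> U"
    using mult_right_mono[OF Q(2)[OF z], of "norm (deriv u z) + norm (deriv v z)"] up by simp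
  then show "norm (deriv u z) + norm (deriv v z) \<le> koebe_mix_deriv \<gamma> (norm z)"
    using z1 by (simp add: koebe_mix_deriv_def U_def pos_le_divide_eq mult.commute)
  have "L \<le> norm a - norm b"
  proof -
    obtain e where e: "norm e = 1" "e * b = of_real (norm b) * (- 1)" using unimodular_rotation[of "- 1"] by auto
    show ?thesis using *(2)[OF e(1)] complex_Re_le_cmod[of a] e(2) by (simp add: L_def)
  qed
  then have lo: "L \<le> norm (Q z) * (norm (deriv u z) - norm (deriv v z))"
    by (simp add: a_def b_def norm_mult algebra_simps)
  then have "norm (deriv u z) - norm (deriv v z) > 0"
    using L0 by (metis less_le_trans norm_ge_zero zero_less_mult_pos norm_zero mult_zero_left less_irrefl order_le_less)
  then have "L \<le> (1 + norm z)\<^sup>2 * (norm (deriv u z) - norm (deriv v z))"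
    by (intro order.trans[OF lo] mult_right_mono Q(3)[OF z]) auto
  then show "norm (deriv u z) - norm (deriv v z) \<ge> koebe_mix_deriv \<gamma> (- norm z)"
    using z1 by (simp add: koebe_mix_deriv_def L_def pos_divide_le_eq mult.commute)
qed

lemma has_derivative_harmonic:
  assumes dec: "harmonic_decomposition f u v" and z: "z \<in> ball 0 1"
  shows "(f has_derivative (\<lambda>h. deriv u z * h + cnj (deriv v z * h))) (at z)"
proof -
  have u: "(u has_derivative (*) (deriv u z)) (at z)" "(v has_derivative (*) (deriv v z)) (at z)"
    using dec holomorphic_derivI[OF _ open_ball z, of _ UNIV]
    by (auto simp: harmonic_decomposition_def has_field_derivative_def)
  have "((\<lambda>w. u w + cnj (v w)) has_derivative (\<lambda>h. deriv u z * h + cnj (deriv v z * h))) (at z)"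
    by (intro has_derivative_add u bounded_linear.has_derivative[OF bounded_linear_cnj])
  then show ?thesis
    by (rule has_derivative_transform_within_open[OF _ open_ball z])
      (use dec in \<open>auto simp: harmonic_decomposition_def\<close>)
qed

text \<open>
  The real derivative \<open>h \<mapsto> u' h + cnj (v' h)\<close> of \<open>f\<close> stretches by a factor between \<open>\<bar>u'\<bar> - \<bar>v'\<bar>\<close> and
  \<open>\<bar>u'\<bar> + \<bar>v'\<bar>\<close>. The upper bound follows by integration along the radius to \<open>z\<close>, the lower one from
  \<open>injective_expanding_norm_ge\<close>.
\<close>

lemma close_to_convex_growth:
  fixes \<gamma> :: real
  assumes k: "k > 0" and g: "0 \<le> \<gamma>" "\<gamma> < 1"
    and phi: "\<phi> \<in> starlike_class ((real k - 1) / real k)"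
    and f: "f \<in> KH0 k \<gamma> \<phi>" and z: "z \<in> ball 0 1"
  shows "norm (f z) \<le> koebe_mix \<gamma> (norm z)" and "norm (f z) \<ge> - koebe_mix \<gamma> (- norm z)"
proof -
  obtain u v where dec: "harmonic_decomposition f u v"
    and re: "\<And>z. z \<in> ball 0 1 \<Longrightarrow> Re (rotation_quotient k \<phi> z * deriv u z - of_real \<gamma>)
                        > norm (rotation_quotient k \<phi> z * deriv v z)"
    and inj: "inj_on f (ball 0 1)"
    using f by (auto simp: KH0_def SH0_def)
  have dil: "norm (deriv u w) + norm (deriv v w) \<le> koebe_mix_deriv \<gamma> (norm w)"
      "norm (deriv u w) - norm (deriv v w) \<ge> koebe_mix_deriv \<gamma> (- norm w)" if w: "w \<in> ball 0 1" for w
    by (rule close_to_convex_derivative_bounds[OF k g phi dec _ w]; rule re; assumption)+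
  note der = has_derivative_harmonic[OF dec]
  have f0: "f 0 = 0" using dec by (simp add: harmonic_decomposition_def)
  define r where "r = norm z"
  have r: "0 \<le> r" "r < 1" using z by (auto simp: r_def)
  have tz: "of_real t * z \<in> ball 0 1" "norm (of_real t * z) = t * r" "t * r < 1" if "0 \<le> t" "t \<le> 1" for t :: real
    using that r mult_left_le_one_le[of r t] by (auto simp: norm_mult r_def)
  have df: "((\<lambda>t. f (of_real t * z)) has_vector_derivative
      (deriv u (of_real t * z) * z + cnj (deriv v (of_real t * z) * z))) (at t)" if t: "0 \<le> t" "t \<le> 1" for t
  proof -
    have "((\<lambda>t. of_real t * z) has_derivative (\<lambda>s. of_real s * z)) (at t)"
      by (auto intro!: derivative_eq_intros)
    from has_derivative_compose[OF this, of f, OF der[OF tz(1)[OF t]]]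
    show ?thesis by (simp add: has_vector_derivative_def scaleR_conv_of_real algebra_simps)
  qed
  have dK: "((\<lambda>t. koebe_mix \<gamma> (t * r)) has_vector_derivative (koebe_mix_deriv \<gamma> (t * r) * r)) (at t)"
    if t: "0 \<le> t" "t \<le> 1" for t
    unfolding has_real_derivative_iff_has_vector_derivative[symmetric]
    by (rule DERIV_chain2[OF has_field_derivative_koebe_mix]) (use tz(3)[OF t] in \<open>auto intro!: derivative_eq_intros\<close>)
  have "norm (f (of_real 1 * z) - f (of_real 0 * z)) \<le> koebe_mix \<gamma> (1 * r) - koebe_mix \<gamma> (0 * r)"
  proof (rule differentiable_bound_general[where f = "\<lambda>t. f (of_real t * z)" and \<phi> = "\<lambda>t. koebe_mix \<gamma> (t * r)" and a = 0 and b = 1])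
    show "continuous_on {0..1} (\<lambda>t. f (of_real t * z))" "continuous_on {0..1} (\<lambda>t. koebe_mix \<gamma> (t * r))"
      using df dK by (auto intro!: continuous_at_imp_continuous_on has_vector_derivative_continuous)
    fix t :: real assume t: "0 < t" "t < 1"
    show "((\<lambda>t. f (of_real t * z)) has_vector_derivative
      (deriv u (of_real t * z) * z + cnj (deriv v (of_real t * z) * z))) (at t)" using df t by simp
    show "((\<lambda>t. koebe_mix \<gamma> (t * r)) has_vector_derivative (koebe_mix_deriv \<gamma> (t * r) * r)) (at t)"
      using dK t by simp
    have "norm (deriv u (of_real t * z) * z + cnj (deriv v (of_real t * z) * z)) \<le>
      (norm (deriv u (of_real t * z)) + norm (deriv v (of_real t * z))) * r"
      using norm_triangle_ineq[of "deriv u (of_real t * z) * z" "cnj (deriv v (of_real t * z) * z)"]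
      by (simp add: norm_mult r_def algebra_simps)
    also have "\<dots> \<le> koebe_mix_deriv \<gamma> (t * r) * r"
      using dil(1)[OF tz(1), of t] tz(2)[of t] t r by (intro mult_right_mono) auto
    finally show "norm (deriv u (of_real t * z) * z + cnj (deriv v (of_real t * z) * z)) \<le> koebe_mix_deriv \<gamma> (t * r) * r" .
  qed simp
  then show "norm (f z) \<le> koebe_mix \<gamma> (norm z)" using f0 by (simp add: r_def)
  show "norm (f z) \<ge> - koebe_mix \<gamma> (- norm z)"
  proof (rule injective_expanding_norm_ge[OF inj f0 der _ _ _ _ z, where M = "\<lambda>t. - koebe_mix \<gamma> (- t)" and m = "\<lambda>t. koebe_mix_deriv \<gamma> (- t)"])
    fix t :: real assume t: "0 \<le> t" "t < 1"
    show "((\<lambda>t. - koebe_mix \<gamma> (- t)) has_real_derivative koebe_mix_deriv \<gamma> (- t)) (at t)"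
    proof -
      have "((\<lambda>t. koebe_mix \<gamma> (- t)) has_real_derivative koebe_mix_deriv \<gamma> (- t) * (- 1)) (at t)"
        by (rule DERIV_chain2[where g = uminus, OF has_field_derivative_koebe_mix])
          (use t in \<open>auto intro!: derivative_eq_intros\<close>)
      from DERIV_minus[OF this] show ?thesis by simp
    qed
    show "koebe_mix_deriv \<gamma> (- t) > 0"
    proof -
      have "0 < \<gamma> + (1 - \<gamma>) * ((1 - t) / (1 + t))"
        using t g mult_pos_pos[of "1 - \<gamma>" "(1 - t) / (1 + t)"] by (intro add_nonneg_pos) auto
      then show ?thesis using t by (simp add: koebe_mix_deriv_def)
    qed
  next
    fix w h :: complex assume w: "w \<in> ball 0 1"
    have "koebe_mix_deriv \<gamma> (- norm w) * norm h \<le> (norm (deriv u w) - norm (deriv v w)) * norm h"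
      using dil(2)[OF w] by (intro mult_right_mono) auto
    also have "\<dots> \<le> norm (deriv u w * h + cnj (deriv v w * h))"
      using norm_diff_ineq[of "deriv u w * h" "cnj (deriv v w * h)"] by (simp add: norm_mult algebra_simps)
    finally show "koebe_mix_deriv \<gamma> (- norm w) * norm h \<le> norm (deriv u w * h + cnj (deriv v w * h))" .
  qed simp_all
qed

section \<open>Sharpness and the growth theorem\<close>

lemma extremal_eq: "z \<in> ball 0 1 \<Longrightarrow> extremal \<gamma> z = koebe_mix \<gamma> z"
  using koebe_mix_infsum[of z \<gamma>] by (simp add: extremal_def)

text \<open>
  In the variable \<open>w = z / (1 - z)\<close>, whose real part exceeds \<open>- 1 / 2\<close>, the function is \<open>w + (1 - \<gamma>) w\<^sup>2\<close>. Two
  distinct points with equal values would satisfy \<open>1 + (1 - \<gamma>) (w\<^sub>1 + w\<^sub>2) = 0\<close>, but the real part of the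
  left-hand side is greater than \<open>1 - (1 - \<gamma>) = \<gamma> \<ge> 0\<close>.
\<close>

lemma inj_on_koebe_mix:
  assumes g: "0 \<le> \<gamma>" "\<gamma> < 1"
  shows "inj_on (koebe_mix \<gamma> :: complex \<Rightarrow> complex) (ball 0 1)"
proof (rule inj_onI)
  fix x y :: complex
  assume xy: "x \<in> ball 0 1" "y \<in> ball 0 1" and eq: "koebe_mix \<gamma> x = koebe_mix \<gamma> y"
  define w where "w x = x / (1 - x)" for x :: complex
  have rew: "Re (w x) > - 1 / 2" if "x \<in> ball 0 1" for x
  proof -
    have x1: "1 - x \<noteq> 0" using that by auto
    have "Re (w x) = Re (x * cnj (1 - x)) / (norm (1 - x))\<^sup>2"
      by (simp add: w_def complex_div_cnj[of x])
    moreover have "Re (x * cnj (1 - x)) + (norm (1 - x))\<^sup>2 / 2 = (1 - (norm x)\<^sup>2) / 2"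
      unfolding cmod_power2 by (simp add: power2_eq_square field_simps)
    moreover have "(norm x)\<^sup>2 < 1" using that by (simp add: abs_square_less_1)
    ultimately have "- 1 / 2 * (norm (1 - x))\<^sup>2 < Re (w x) * (norm (1 - x))\<^sup>2" using x1 by simp
    then show ?thesis by (rule mult_right_less_imp_less) simp
  qed
  have K: "koebe_mix \<gamma> x = w x + of_real (1 - \<gamma>) * (w x)\<^sup>2" if "x \<in> ball 0 1" for x
  proof -
    have x1: "1 - x \<noteq> 0" using that by auto
    have "x / (1 - x)\<^sup>2 = w x + (w x)\<^sup>2"
      using x1 by (simp add: w_def divide_simps) (simp add: power2_eq_square algebra_simps)
    then show ?thesis by (simp add: koebe_mix_def w_def[symmetric] algebra_simps)
  qed
  have "(w x - w y) * (1 + of_real (1 - \<gamma>) * (w x + w y)) = 0"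
    using eq unfolding K[OF xy(1)] K[OF xy(2)] by (simp add: power2_eq_square algebra_simps)
  moreover have "Re (1 + of_real (1 - \<gamma>) * (w x + w y)) > 0"
  proof -
    have "(1 - \<gamma>) * (- 1) < (1 - \<gamma>) * (Re (w x) + Re (w y))"
      using g rew[OF xy(1)] rew[OF xy(2)] by (intro mult_strict_left_mono) auto
    then show ?thesis using g by simp
  qed
  ultimately have "w x = w y" by (metis eq_iff_diff_eq_0 less_irrefl mult_eq_0_iff zero_complex.sel(1))
  moreover have "1 - x \<noteq> 0" "1 - y \<noteq> 0" using xy by auto
  ultimately show "x = y" by (simp add: w_def frac_eq_eq algebra_simps)
qed

lemma re_cayley_pos:
  assumes "norm z < 1"
  shows "Re ((1 + z) / (1 - z)) > 0"
proof -
  have z1: "1 - z \<noteq> 0" using assms by auto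
  have "Re ((1 + z) / (1 - z)) = Re ((1 + z) * cnj (1 - z)) / (norm (1 - z))\<^sup>2"
    by (simp add: complex_div_cnj[of "1 + z"])
  moreover have "Re ((1 + z) * cnj (1 - z)) = 1 - (norm z)\<^sup>2"
    unfolding cmod_power2 by (simp add: power2_eq_square algebra_simps)
  moreover have "(norm z)\<^sup>2 < 1" using assms by (simp add: abs_square_less_1)
  ultimately show ?thesis using z1 by simp
qed

lemma koebe_starlike: "(koebe_mix 0 :: complex \<Rightarrow> complex) \<in> starlike_class 0"
proof -
  have hol: "(koebe_mix 0 :: complex \<Rightarrow> complex) holomorphic_on ball 0 1"
    by (subst holomorphic_on_open) (auto intro!: exI has_field_derivative_koebe_mix)
  show ?thesis
    unfolding starlike_class_def mem_Collect_eq
  proof (intro conjI ballI)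
    show "deriv (koebe_mix 0 :: complex \<Rightarrow> complex) 0 = 1"
      using DERIV_imp_deriv[OF has_field_derivative_koebe_mix[of "0::complex" 0]]
      by (simp add: koebe_mix_deriv_def)
    fix z :: complex assume z: "z \<in> ball 0 1 - {0}"
    then have z1: "1 - z \<noteq> 0" "z \<noteq> 0" "z \<noteq> 1" by auto
    show "koebe_mix 0 z \<noteq> 0" using z1 by (simp add: koebe_mix_def)
    have "z * deriv (koebe_mix 0) z / koebe_mix 0 z = (1 + z) / (1 - z)"
      using z1 by (simp add: DERIV_imp_deriv[OF has_field_derivative_koebe_mix] koebe_mix_def koebe_mix_deriv_def)
    then show "Re (z * deriv (koebe_mix 0) z / koebe_mix 0 z) > 0"
      using re_cayley_pos[of z] z by simp
  qed (use hol in simp_all)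
qed

text \<open>
  For the Koebe function the quotient \<open>z / \<phi> z\<close> is \<open>(1 - z)\<^sup>2\<close>, which cancels the denominator of the derivative
  and leaves \<open>\<gamma> + (1 - \<gamma>) (1 + z) / (1 - z)\<close>; the Cayley transform has positive real part.
\<close>

lemma extremal_in_KH0:
  assumes g: "0 \<le> \<gamma>" "\<gamma> < 1"
  shows "extremal \<gamma> \<in> KH0 1 \<gamma> (koebe_mix 0)"
proof -
  have der: "(extremal \<gamma> has_field_derivative koebe_mix_deriv \<gamma> z) (at z)" if z: "z \<in> ball 0 1" for z
  proof -
    have "z \<noteq> 1" using z by auto
    show ?thesis
      by (rule has_field_derivative_transform_within_open[OF has_field_derivative_koebe_mix[OF \<open>z \<noteq> 1\<close>] open_ball z])
        (simp add: extremal_eq)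
  qed
  have deriv: "deriv (extremal \<gamma>) z = koebe_mix_deriv \<gamma> z" if "z \<in> ball 0 1" for z
    using der[OF that] by (rule DERIV_imp_deriv)
  have dec: "harmonic_decomposition (extremal \<gamma>) (extremal \<gamma>) (\<lambda>_. 0)"
  proof -
    have "extremal \<gamma> holomorphic_on ball 0 1"
      by (subst holomorphic_on_open) (use der in blast)+
    then show ?thesis
      unfolding harmonic_decomposition_def by (simp add: extremal_eq deriv koebe_mix_deriv_def)
  qed
  have Q: "rotation_quotient 1 (koebe_mix 0) z = (1 - z)\<^sup>2" for z
    by (simp add: rotation_quotient_def rotation_product_def koebe_mix_def)
  have main: "Re (rotation_quotient 1 (koebe_mix 0) z * deriv (extremal \<gamma>) z) > \<gamma>" if z: "z \<in> ball 0 1" for z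
  proof -
    have z1: "1 - z \<noteq> 0" using z by auto
    have "rotation_quotient 1 (koebe_mix 0) z * deriv (extremal \<gamma>) z
        = of_real \<gamma> + of_real (1 - \<gamma>) * ((1 + z) / (1 - z))"
      unfolding Q deriv[OF z] koebe_mix_deriv_def using z1 by simp
    moreover have "Re (of_real \<gamma> + of_real (1 - \<gamma>) * X) = \<gamma> + (1 - \<gamma>) * Re X" for X
      by simp
    ultimately have "Re (rotation_quotient 1 (koebe_mix 0) z * deriv (extremal \<gamma>) z)
        = \<gamma> + (1 - \<gamma>) * Re ((1 + z) / (1 - z))"
      by metis
    then show ?thesis using re_cayley_pos[of z] z g by simp
  qed
  have "deriv (extremal \<gamma>) z \<noteq> 0" if "z \<in> ball 0 1" for z
    using main[OF that] g by auto
  moreover have "inj_on (extremal \<gamma>) (ball 0 1)"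
    using inj_on_koebe_mix[OF g] by (simp add: inj_on_def extremal_eq)
  ultimately have "extremal \<gamma> \<in> SH0"
    unfolding SH0_def mem_Collect_eq
    by (intro conjI exI[of _ "extremal \<gamma>"] exI[of _ "\<lambda>_. 0"] dec) simp_all
  then show ?thesis
    unfolding KH0_def mem_Collect_eq
    by (intro conjI exI[of _ "extremal \<gamma>"] exI[of _ "\<lambda>_. 0"] dec ballI) (use main in simp_all)
qed

theorem theorem3p8:
  fixes k :: nat and \<gamma> :: real
  assumes "k > 0" and "0 \<le> \<gamma>" and "\<gamma> < 1"
  shows "(\<forall>\<phi> \<in> starlike_class ((real k - 1) / real k). \<forall>f \<in> KH0 k \<gamma> \<phi>. \<forall>z \<in> unit_disc.
            norm z + (\<Sum>\<^sub>\<infinity>m\<in>{2..}. (-1) ^ (m - 1) * (real m * (1 - \<gamma>) + \<gamma>) * norm z ^ m)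
              \<le> norm (f z) \<and>
            norm (f z) \<le> norm z + (\<Sum>\<^sub>\<infinity>m\<in>{2..}. (real m * (1 - \<gamma>) + \<gamma>) * norm z ^ m)) \<and>
         (\<exists>\<phi> \<in> starlike_class 0. extremal \<gamma> \<in> KH0 1 \<gamma> \<phi>) \<and>
         (\<forall>r::real. 0 \<le> r \<and> r < 1 \<longrightarrow>
            norm (extremal \<gamma> (- of_real r)) =
              r + (\<Sum>\<^sub>\<infinity>m\<in>{2..}. (-1) ^ (m - 1) * (real m * (1 - \<gamma>) + \<gamma>) * r ^ m) \<and>
            norm (extremal \<gamma> (of_real r)) =
              r + (\<Sum>\<^sub>\<infinity>m\<in>{2..}. (real m * (1 - \<gamma>) + \<gamma>) * r ^ m))"
proof (intro conjI ballI allI impI)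
  fix \<phi> f z
  assume phi: "\<phi> \<in> starlike_class ((real k - 1) / real k)" and f: "f \<in> KH0 k \<gamma> \<phi>"
    and z: "z \<in> unit_disc"
  have z1: "0 \<le> norm z" "norm z < 1" using z by auto
  note gr = close_to_convex_growth[OF assms phi f z]
  show "norm z + (\<Sum>\<^sub>\<infinity>m\<in>{2..}. (-1) ^ (m - 1) * (real m * (1 - \<gamma>) + \<gamma>) * norm z ^ m) \<le> norm (f z)"
    using gr(2) unfolding koebe_mix_infsum_real(2)[OF z1] .
  show "norm (f z) \<le> norm z + (\<Sum>\<^sub>\<infinity>m\<in>{2..}. (real m * (1 - \<gamma>) + \<gamma>) * norm z ^ m)"
    using gr(1) unfolding koebe_mix_infsum_real(1)[OF z1] .
next
  show "\<exists>\<phi> \<in> starlike_class 0. extremal \<gamma> \<in> KH0 1 \<gamma> \<phi>"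
    using koebe_starlike extremal_in_KH0[OF assms(2,3)] by blast
next
  fix r :: real assume "0 \<le> r \<and> r < 1"
  then have r: "0 \<le> r" "r < 1" by auto
  have of_real: "koebe_mix \<gamma> (of_real x :: complex) = of_real (koebe_mix \<gamma> x)" for x :: real
    by (simp add: koebe_mix_def)
  have "norm (extremal \<gamma> (of_real (- r))) = \<bar>koebe_mix \<gamma> (- r)\<bar>"
    using r by (subst extremal_eq) (simp_all add: of_real del: of_real_minus)
  moreover have "koebe_mix \<gamma> (- r) \<le> 0"
  proof -
    have "0 \<le> (1 - \<gamma>) * (r / (1 + r)\<^sup>2) + \<gamma> * (r / (1 + r))"
      using r assms by (intro add_nonneg_nonneg mult_nonneg_nonneg divide_nonneg_nonneg) auto
    then show ?thesis by (simp add: koebe_mix_def)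
  qed
  ultimately show "norm (extremal \<gamma> (- of_real r)) =
      r + (\<Sum>\<^sub>\<infinity>m\<in>{2..}. (-1) ^ (m - 1) * (real m * (1 - \<gamma>) + \<gamma>) * r ^ m)"
    unfolding koebe_mix_infsum_real(2)[OF r] by simp
  have "norm (extremal \<gamma> (of_real r)) = \<bar>koebe_mix \<gamma> r\<bar>"
    using r by (subst extremal_eq) (simp_all add: of_real)
  moreover have "koebe_mix \<gamma> r \<ge> 0"
    using r assms by (simp add: koebe_mix_def)
  ultimately show "norm (extremal \<gamma> (of_real r)) =
      r + (\<Sum>\<^sub>\<infinity>m\<in>{2..}. (real m * (1 - \<gamma>) + \<gamma>) * r ^ m)"
    unfolding koebe_mix_infsum_real(1)[OF r] by simp
qed

end
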